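(* Let $f:\mathcal{X}\to\mathcal{Y}$ be a fixed piecewise linear ReLU network with activation regions $a_1,\dots,a_C$ and subfunctions $H=(h_1,\dots,h_C)$, let $r$ be a per-sample error function with $0\le r((x,y);f)\le 1$ for all $(x,y)\in\mathcal{X}\times\mathcal{Y}$, and let $k:H\times H\to\mathbb{R}_{\ge 0}$ be a fixed non-negative weighting function. Let $N_1,\dots,N_C\ge 0$ be fixed integers with $N=\sum_{i=1}^C N_i\ge 1$, and for each $i$ let $D_i$ be the data distribution of activation region $a_i$. Let $\tilde D_S$ be the distribution over size-$N$ datasets that have activation region data distributions $D_i$ and activation region dataset sizes $N_i$ for all $i\in\{1,\dots,C\}$, and let the dataset $S$ be drawn from $\tilde D_S$. Define $$\mathbb{P}(h_i)=\frac{\sum_{j=1}^C N_j\,k(h_i,h_j)}{\sum_{l=1}^C\sum_{j=1}^C N_j\,k(h_l,h_j)},\qquad \widehat R^*_S(h_i)=\frac1N\sum_{(x,y)\in S}\frac{k(H(x),h_i)\,r((x,y);f)}{\sum_{j=1}^C\mathbb{P}(h_j)\,k(H(x),h_j)},$$ where $H(x)$ is the subfunction induced by $x$. Assume that the denominators appearing in these definitions are positive and that $\mathbb{P}(h_i)>0$ for the index $i$ considered. Then for every such $i\in\{1,\dots,C\}$ and every $\delta\in(0,1]$, with probability $>1-\delta$ over the draw of $S\sim\tilde D_S$, $$R^*_{\tilde D_S}(h_i):=\mathbb{E}_{S\sim\tilde D_S}\big[\widehat R^*_S(h_i)\big]\;\le\;\widehat R^*_S(h_i)+\frac{1}{\m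athbb{P}(h_i)}\sqrt{\frac{\log\frac{2}{\delta}}{2N}}.$$
   Context: Network and regions. $f:\mathcal{X}\to\mathcal{Y}$ is a neural network composed of linear functions and $M$ ReLU activations. For $1\le j\le M$, $v_j:\mathcal{X}\to\{0,1\}$ is $1$ if the $j$-th ReLU is positive valued when $f(x)$ is computed and $0$ otherwise. $P=(p_i)_{1\le i\le C}\subset\{0,1\}^M$ is the finite set of all patterns $(v_1(x),\dots,v_M(x))$ attained as $x$ ranges over $\mathcal{X}$. The activation region of $p_i$ is $a_i=\{x\in\mathcal{X} : p_i^j=v_j(x)\ \forall j\in\{1,\dots,M\}\}$; the regions $a_1,\dots,a_C$ partition $\mathcal{X}$. The subfunction $h_i:\mathcal{X}\to\mathcal{Y}$ is obtained from $f$ by replacing the $j$-th ReLU by the identity if $p_i^j=1$ and by the zero function otherwise, for every $j$, so $f(x)=h_i(x)$ for $x\in a_i$. Subfunctions are indexed by their patterns and treated as distinct for distinct patterns; $H=(h_i)_{1\le i\le C}$, and, overloading notation, $H(x)=h_i$ for the unique $i$ with $x\in a_i$. Data. $D$ is a probability distribution on $\mathcal{X}\times\mathcal{Y}$, and $D_i$ is the conditional distribution of $(x,y)\sim D$ given $x\in a_i$ (needed only for those $i$ with $N_i>0$, for which $a_i$ has positive probability under $D$). A dataset $S$ drawn from $\tilde D_S$ consists of $N=\sum_i N_i$ sample pairs, where for each $i$ exactly $N_i$ of them (the samples with input in $a_i$) are drawn i.i.d. from $D_i$, and all $N$ samples are mutually independent; the numbers $N_i$ are fixed (non-random), and the order of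 the samples is immaterial. In particular $\mathbb{P}(h_i)$ is non-random. The error function $r(\cdot\,;f)$ is measurable. The network $f$ and weighting $k$ are fixed independently of the draw of $S$. Equivalently, $\widehat R^*_S(h_i)=\frac1N\sum_{l=1}^C\frac{k(h_l,h_i)\,N_l\,\widehat R_{S_l}(h_l)}{\sum_{j=1}^C\mathbb{P}(h_j)k(h_l,h_j)}$, where $S_l$ is the set of samples of $S$ with input in $a_l$, $\widehat R_{S_l}(h_l)=\frac1{N_l}\sum_{(x,y)\in S_l}r((x,y);f)$, and terms with $N_l=0$ are read as $0$. The denominators assumed positive are $\sum_{l}\sum_j N_j k(h_l,h_j)$ and $\sum_j\mathbb{P}(h_j)k(h_l,h_j)$ for every $l$ with $N_l>0$. *)

theory Defs
  imports "HOL-Probability.Probability"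
begin

text \<open>
  A network composed of affine functions and finitely many scalar ReLUs. The ReLUs are numbered
  in an order of evaluation: the input of ReLU \<open>j\<close> is an affine function of the network input and
  of the outputs of the ReLUs \<open>i < j\<close>, and the network output is an affine function of the network
  input and of all ReLU outputs. Layered networks are the case where \<open>hidden_weight\<close> vanishes
  except between consecutive layers; entries \<open>hidden_weight j i\<close> with \<open>i \<ge> j\<close> are not used.
\<close>

record (overloaded) ('a::euclidean_space, 'b::euclidean_space) relu_net =
  num_relus :: nat
  input_weight :: "nat \<Rightarrow> 'a"
  hidden_weight :: "nat \<Rightarrow> nat \<Rightarrow> real"
  hidden_bias :: "nat \<Rightarrow> real"
  output_skip :: "'a \<Rightarrow>\<^sub>L 'b"
  output_weight :: "nat \<Rightarrow> 'b"
  output_bias :: 'b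

text \<open>
  Evaluation is parametrised by the function \<open>\<sigma> j\<close> used in place of the \<open>j\<close>-th ReLU, so that the
  network and its subfunctions are instances of the same definition.
\<close>

fun preactivation ::
  "('a::euclidean_space, 'b::euclidean_space) relu_net \<Rightarrow> (nat \<Rightarrow> real \<Rightarrow> real) \<Rightarrow> 'a \<Rightarrow> nat \<Rightarrow> real"
where
  "preactivation net \<sigma> x j =
     input_weight net j \<bullet> x + hidden_bias net j
     + (\<Sum>i<j. hidden_weight net j i * \<sigma> i (preactivation net \<sigma> x i))"

declare preactivation.simps [simp del]

definition eval_net ::
  "('a::euclidean_space, 'b::euclidean_space) relu_net \<Rightarrow> (nat \<Rightarrow> real \<Rightarrow> real) \<Rightarrow> 'a \<Rightarrow> 'b"
where
  "eval_net net \<sigma> x =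
     blinfun_apply (output_skip net) x + output_bias net
     + (\<Sum>j<num_relus net. \<sigma> j (preactivation net \<sigma> x j) *\<^sub>R output_weight net j)"

definition relu :: "real \<Rightarrow> real" where
  "relu z = max 0 z"

definition network :: "('a::euclidean_space, 'b::euclidean_space) relu_net \<Rightarrow> 'a \<Rightarrow> 'b" where
  "network net = eval_net net (\<lambda>_. relu)"

definition active :: "('a::euclidean_space, 'b::euclidean_space) relu_net \<Rightarrow> nat \<Rightarrow> 'a \<Rightarrow> bool" where
  "active net j x \<longleftrightarrow> relu (preactivation net (\<lambda>_. relu) x j) > 0"

definition pattern :: "('a::euclidean_space, 'b::euclidean_space) relu_net \<Rightarrow> 'a \<Rightarrow> bool list" where
  "pattern net x = map (\<lambda>j. active net j x) [0..<num_relus net]"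

definition patterns ::
  "('a::euclidean_space, 'b::euclidean_space) relu_net \<Rightarrow> 'a set \<Rightarrow> bool list set" where
  "patterns net X = pattern net ` X"

definition region ::
  "('a::euclidean_space, 'b::euclidean_space) relu_net \<Rightarrow> 'a set \<Rightarrow> bool list \<Rightarrow> 'a set" where
  "region net X p = {x \<in> X. \<forall>j<num_relus net. p ! j \<longleftrightarrow> active net j x}"

text \<open>
  A subfunction carries its pattern as a tag: different patterns give different subfunctions even
  when the underlying functions coincide. The indices \<open>i = 1, \<dots>, C\<close> of regions and subfunctions
  are throughout represented by the patterns themselves.
\<close>

type_synonym ('a, 'b) subfun = "bool list \<times> ('a \<Rightarrow> 'b)"

definition subfunction ::
  "('a::euclidean_space, 'b::euclidean_space) relu_net \<Rightarrow> bool list \<Rightarrow> ('a, 'b) subfun" where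
  "subfunction net p = (p, eval_net net (\<lambda>j z. if p ! j then z else 0))"

definition induced_subfunction ::
  "('a::euclidean_space, 'b::euclidean_space) relu_net \<Rightarrow> 'a \<Rightarrow> ('a, 'b) subfun" where
  "induced_subfunction net x = subfunction net (pattern net x)"

lemma finite_patterns: "finite (patterns net X)"
proof (rule finite_subset)
  show "patterns net X \<subseteq> {p. set p \<subseteq> UNIV \<and> length p = num_relus net}"
    by (auto simp: patterns_def pattern_def)
qed (rule finite_lists_length_eq, simp)

lemma region_eq:
  assumes "p \<in> patterns net X"
  shows "region net X p = {x \<in> X. pattern net x = p}"
  using assms by (auto simp: region_def patterns_def pattern_def)

lemma network_eq_subfunction:
  assumes "x \<in> region net X p"
  shows "network net x = snd (subfunction net p) x"
proof -
  let ?g = "\<lambda>j z. if p ! j then z else (0::real)"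
  have gate: "relu (preactivation net (\<lambda>_. relu) x j) = ?g j (preactivation net (\<lambda>_. relu) x j)"
    if "j < num_relus net" for j
    using assms that by (auto simp: region_def active_def relu_def)
  have pre: "preactivation net (\<lambda>_. relu) x j = preactivation net ?g x j"
    if "j < num_relus net" for j
    using that
  proof (induction j rule: less_induct)
    case (less j)
    have "(\<Sum>i<j. hidden_weight net j i * relu (preactivation net (\<lambda>_. relu) x i))
        = (\<Sum>i<j. hidden_weight net j i * ?g i (preactivation net ?g x i))"
    proof (rule sum.cong[OF refl])
      fix i assume "i \<in> {..<j}"
      then have i: "i < j" "i < num_relus net" using less.prems by auto
      show "hidden_weight net j i * relu (preactivation net (\<lambda>_. relu) x i)
          = hidden_weight net j i * ?g i (preactivation net ?g x i)"
        using gate[OF i(2)] less.IH[OF i] by simp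
    qed
    then show ?case
      by (subst (1 2) preactivation.simps) simp
  qed
  have "(\<Sum>j<num_relus net. relu (preactivation net (\<lambda>_. relu) x j) *\<^sub>R output_weight net j)
      = (\<Sum>j<num_relus net. ?g j (preactivation net ?g x j) *\<^sub>R output_weight net j)"
  proof (rule sum.cong[OF refl])
    fix j assume "j \<in> {..<num_relus net}"
    then have j: "j < num_relus net" by simp
    show "relu (preactivation net (\<lambda>_. relu) x j) *\<^sub>R output_weight net j
        = ?g j (preactivation net ?g x j) *\<^sub>R output_weight net j"
      using gate[OF j] pre[OF j] by simp
  qed
  then show ?thesis
    by (simp add: network_def eval_net_def subfunction_def)
qed

definition data_algebra ::
  "'a::euclidean_space set \<Rightarrow> 'b::euclidean_space set \<Rightarrow> ('a \<times> 'b) measure" where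
  "data_algebra X Y = restrict_space borel X \<Otimes>\<^sub>M restrict_space borel Y"

text \<open>
  \<open>uniform_measure D A\<close> is \<open>D\<close> conditioned on \<open>A\<close>.
\<close>

definition region_distribution ::
  "('a::euclidean_space, 'b::euclidean_space) relu_net \<Rightarrow> 'a set \<Rightarrow> 'b set \<Rightarrow> ('a \<times> 'b) measure
    \<Rightarrow> bool list \<Rightarrow> ('a \<times> 'b) measure" where
  "region_distribution net X Y D p = uniform_measure D (region net X p \<times> Y)"

text \<open>
  A dataset is a family \<open>S\<close> of sample pairs; the sample \<open>S (p, n)\<close>, \<open>n < N p\<close>, is the \<open>n\<close>-th of
  those drawn from the distribution of region \<open>p\<close>.
\<close>

definition sample_index ::
  "('a::euclidean_space, 'b::euclidean_space) relu_net \<Rightarrow> 'a set \<Rightarrow> (bool list \<Rightarrow> nat)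
    \<Rightarrow> (bool list \<times> nat) set" where
  "sample_index net X N = (SIGMA p:patterns net X. {..<N p})"

definition dataset_distribution ::
  "('a::euclidean_space, 'b::euclidean_space) relu_net \<Rightarrow> 'a set \<Rightarrow> 'b set \<Rightarrow> ('a \<times> 'b) measure
    \<Rightarrow> (bool list \<Rightarrow> nat) \<Rightarrow> (bool list \<times> nat \<Rightarrow> 'a \<times> 'b) measure" where
  "dataset_distribution net X Y D N =
     (\<Pi>\<^sub>M s\<in>sample_index net X N. region_distribution net X Y D (fst s))"

definition dataset_size ::
  "('a::euclidean_space, 'b::euclidean_space) relu_net \<Rightarrow> 'a set \<Rightarrow> (bool list \<Rightarrow> nat) \<Rightarrow> nat" where
  "dataset_size net X N = (\<Sum>p\<in>patterns net X. N p)"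

definition total_weight ::
  "('a::euclidean_space, 'b::euclidean_space) relu_net \<Rightarrow> 'a set
    \<Rightarrow> (('a, 'b) subfun \<Rightarrow> ('a, 'b) subfun \<Rightarrow> real) \<Rightarrow> (bool list \<Rightarrow> nat) \<Rightarrow> real" where
  "total_weight net X k N =
     (\<Sum>l\<in>patterns net X. \<Sum>j\<in>patterns net X.
        real (N j) * k (subfunction net l) (subfunction net j))"

definition subfunction_prob ::
  "('a::euclidean_space, 'b::euclidean_space) relu_net \<Rightarrow> 'a set
    \<Rightarrow> (('a, 'b) subfun \<Rightarrow> ('a, 'b) subfun \<Rightarrow> real) \<Rightarrow> (bool list \<Rightarrow> nat) \<Rightarrow> bool list \<Rightarrow> real" where
  "subfunction_prob net X k N i =
     (\<Sum>j\<in>patterns net X. real (N j) * k (subfunction net i) (subfunction net j))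
     / total_weight net X k N"

definition smoothing_weight ::
  "('a::euclidean_space, 'b::euclidean_space) relu_net \<Rightarrow> 'a set
    \<Rightarrow> (('a, 'b) subfun \<Rightarrow> ('a, 'b) subfun \<Rightarrow> real) \<Rightarrow> (bool list \<Rightarrow> nat) \<Rightarrow> ('a, 'b) subfun \<Rightarrow> real"
where
  "smoothing_weight net X k N h =
     (\<Sum>j\<in>patterns net X. subfunction_prob net X k N j * k h (subfunction net j))"

definition empirical_risk ::
  "('a::euclidean_space, 'b::euclidean_space) relu_net \<Rightarrow> 'a set
    \<Rightarrow> ('a \<times> 'b \<Rightarrow> ('a \<Rightarrow> 'b) \<Rightarrow> real)
    \<Rightarrow> (('a, 'b) subfun \<Rightarrow> ('a, 'b) subfun \<Rightarrow> real) \<Rightarrow> (bool list \<Rightarrow> nat)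
    \<Rightarrow> (bool list \<times> nat \<Rightarrow> 'a \<times> 'b) \<Rightarrow> bool list \<Rightarrow> real" where
  "empirical_risk net X r k N S i =
     1 / real (dataset_size net X N) *
     (\<Sum>s\<in>sample_index net X N.
        k (induced_subfunction net (fst (S s))) (subfunction net i) * r (S s) (network net)
        / smoothing_weight net X k N (induced_subfunction net (fst (S s))))"

definition expected_risk ::
  "('a::euclidean_space, 'b::euclidean_space) relu_net \<Rightarrow> 'a set \<Rightarrow> 'b set \<Rightarrow> ('a \<times> 'b) measure
    \<Rightarrow> ('a \<times> 'b \<Rightarrow> ('a \<Rightarrow> 'b) \<Rightarrow> real)
    \<Rightarrow> (('a, 'b) subfun \<Rightarrow> ('a, 'b) subfun \<Rightarrow> real) \<Rightarrow> (bool list \<Rightarrow> nat) \<Rightarrow> bool list \<Rightarrow> real" where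
  "expected_risk net X Y D r k N i =
     (\<integral>S. empirical_risk net X r k N S i \<partial>dataset_distribution net X Y D N)"

end

theory Submission
  imports Defs
begin

text \<open>
  On the support of a sample drawn from the region of \<open>p\<close>, its weight in the empirical risk is the
  constant \<open>k(h\<^sub>p, h\<^sub>i) / (\<Sum>\<^sub>j P(h\<^sub>j) k(h\<^sub>p, h\<^sub>j))\<close>; the denominator contains the summand
  \<open>P(h\<^sub>i) k(h\<^sub>p, h\<^sub>i)\<close>, so the weight is at most \<open>1 / P(h\<^sub>i)\<close>. Hence the empirical risk is a sum of \<open>N\<close>
  independent variables almost surely in \<open>[0, 1 / (N P(h\<^sub>i))]\<close>, and Hoeffding's inequality bounds the
  failure probability by \<open>\<delta> / 2\<close>; the factor 2 is the slack that makes the final inequality strict.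
\<close>

text \<open>Strong induction follows the evaluation order: the input of ReLU \<open>j\<close> is
  built from finitely many outputs of ReLUs with smaller index.\<close>

lemma borel_measurable_preactivation:
  "(\<lambda>x. preactivation net (\<lambda>_. relu) x j) \<in> borel_measurable borel"
proof (induction j rule: less_induct)
  case (less j)
  have [measurable]: "(\<lambda>x. relu (preactivation net (\<lambda>_. relu) x i)) \<in> borel_measurable borel"
    if "i < j" for i
    using less.IH[OF that] unfolding relu_def by measurable
  show ?case
    by (subst preactivation.simps) measurable
qed

text \<open>Patterns lie in a countable type, so measurable fibres suffice, and each fibre is cut
  out by finitely many activation conditions.\<close>

lemma measurable_pattern: "pattern net \<in> borel \<rightarrow>\<^sub>M count_space UNIV"
proof -
  have [measurable]: "Measurable.pred borel (active net j)" for j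
    using borel_measurable_preactivation[of net j] unfolding active_def relu_def by measurable
  have "pattern net -` {p} = {x. length p = num_relus net \<and>
      (\<forall>j\<in>{..<num_relus net}. p ! j \<longleftrightarrow> active net j x)}" for p
    by (auto simp: pattern_def list_eq_iff_nth_eq)
  moreover have "{x. length p = num_relus net \<and>
      (\<forall>j\<in>{..<num_relus net}. p ! j \<longleftrightarrow> active net j x)} \<in> sets borel" for p
    by measurable
  ultimately show ?thesis
    by (subst measurable_count_space_eq2_countable) auto
qed

lemma measurable_pattern_fst:
  "(\<lambda>z. pattern net (fst z)) \<in> data_algebra X Y \<rightarrow>\<^sub>M count_space UNIV"
  unfolding data_algebra_def
  by (rule measurable_compose[OF measurable_fst measurable_restrict_space1[OF measurable_pattern]])

lemma space_data_algebra: "space (data_algebra X Y) = X \<times> Y"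
  by (simp add: data_algebra_def space_pair_measure space_restrict_space)

lemma region_times_in_sets:
  assumes "p \<in> patterns net X"
  shows "region net X p \<times> Y \<in> sets (data_algebra X Y)"
proof -
  have "region net X p \<times> Y
      = (\<lambda>z. pattern net (fst z)) -` {p} \<inter> space (data_algebra X Y)"
    by (auto simp: region_eq[OF assms] space_data_algebra)
  then show ?thesis
    using measurable_sets[OF measurable_pattern_fst, of "{p}" net X Y] by simp
qed

text \<open>Independence amounts to the joint law being the product of the marginals. The joint law
  of the coordinates is \<open>PiM I M\<close> itself, because its points are extensional and
  restricting them to \<open>I\<close> changes nothing.\<close>

lemma indep_vars_PiM_components:
  assumes "\<And>i. i \<in> I \<Longrightarrow> prob_space (M i)" and "I \<noteq> {}"
  shows "prob_space.indep_vars (PiM I M) M (\<lambda>i x. x i) I"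
proof -
  interpret prob_space "PiM I M"
    by (rule prob_space_PiM) (rule assms)
  have "distr (PiM I M) (PiM I M) (\<lambda>x. \<lambda>i\<in>I. x i) = distr (PiM I M) (PiM I M) (\<lambda>x. x)"
    by (intro distr_cong) (auto simp: space_PiM PiE_def extensional_restrict)
  also have "\<dots> = PiM I (\<lambda>i. distr (PiM I M) (M i) (\<lambda>x. x i))"
    by (auto intro!: PiM_cong simp: distr_PiM_component assms distr_id2)
  finally show ?thesis
    by (subst indep_vars_iff_distr_eq_PiM') (auto simp: assms)
qed

text \<open>The range condition is only almost sure because the contribution of a sample is
  controlled only on the region on which its distribution is conditioned.\<close>

lemma Hoeffding_PiM_lower_tail:
  fixes f :: "'i \<Rightarrow> 'a \<Rightarrow> real"
  assumes "finite I" and "I \<noteq> {}"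
    and M: "\<And>i. i \<in> I \<Longrightarrow> prob_space (M i)"
    and f: "\<And>i. i \<in> I \<Longrightarrow> f i \<in> borel_measurable (M i)"
    and AE: "\<And>i. i \<in> I \<Longrightarrow> AE z in M i. f i z \<in> {0..b}"
    and "0 < b" and "0 \<le> \<epsilon>"
  shows "measure (PiM I M) {x \<in> space (PiM I M).
           (\<Sum>i\<in>I. f i (x i)) \<le> (\<integral>x. (\<Sum>i\<in>I. f i (x i)) \<partial>PiM I M) - \<epsilon>}
         \<le> exp (- 2 * \<epsilon>\<^sup>2 / (real (card I) * b\<^sup>2))"
proof -
  interpret prob_space "PiM I M"
    by (rule prob_space_PiM) (rule M)
  interpret Hoeffding_ineq "PiM I M" I "\<lambda>i x. f i (x i)" "\<lambda>_. 0" "\<lambda>_. b"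
    "\<Sum>i\<in>I. expectation (\<lambda>x. f i (x i))"
  proof unfold_locales
    show "indep_vars (\<lambda>_. borel) (\<lambda>i x. f i (x i)) I"
      by (rule indep_vars_compose2[OF indep_vars_PiM_components])
        (simp_all add: M f \<open>I \<noteq> {}\<close>)
    show "AE x in PiM I M. f i (x i) \<in> {0..b}" if "i \<in> I" for i
      by (rule AE_PiM_component[where M = M and P = "\<lambda>z. f i z \<in> {0..b}", OF M that AE[OF that]])
  qed (use \<open>finite I\<close> in simp_all)
  \<comment> \<open>Boundedness gives integrability, which lets the sum of expectations in
    Hoeffding's inequality be read as the expectation of the sum.\<close>
  have "integrable (PiM I M) (\<lambda>x. f i (x i))" if "i \<in> I" for i
    by (rule interval_bounded_random_variable.integrable[OF bounded_random_variable[OF that]])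
  then have "(\<Sum>i\<in>I. expectation (\<lambda>x. f i (x i))) = expectation (\<lambda>x. \<Sum>i\<in>I. f i (x i))"
    by (simp add: Bochner_Integration.integral_sum)
  moreover have "(\<Sum>i\<in>I. (b - 0)\<^sup>2) > 0"
    using assms by (simp add: card_gt_0_iff)
  ultimately show ?thesis
    using Hoeffding_ineq_le[OF \<open>0 \<le> \<epsilon>\<close>] by simp
qed

lemma card_sample_index: "card (sample_index net X N) = dataset_size net X N"
  by (simp add: sample_index_def dataset_size_def finite_patterns)

lemma weight_le_inverse_subfunction_prob:
  assumes k: "\<And>p q. p \<in> patterns net X \<Longrightarrow> q \<in> patterns net X \<Longrightarrow>
      0 \<le> k (subfunction net p) (subfunction net q)"
    and "total_weight net X k N > 0"
    and "smoothing_weight net X k N (subfunction net p) > 0"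
    and "i \<in> patterns net X" and "p \<in> patterns net X"
    and "subfunction_prob net X k N i > 0"
  shows "k (subfunction net p) (subfunction net i) / smoothing_weight net X k N (subfunction net p)
    \<le> 1 / subfunction_prob net X k N i"
proof -
  \<comment> \<open>With all summands of the smoothing weight nonnegative, a single one is at most
    the whole sum.\<close>
  have "subfunction_prob net X k N q \<ge> 0" if "q \<in> patterns net X" for q
    using assms that unfolding subfunction_prob_def
    by (intro divide_nonneg_pos sum_nonneg mult_nonneg_nonneg) auto
  then have "subfunction_prob net X k N i * k (subfunction net p) (subfunction net i)
      \<le> smoothing_weight net X k N (subfunction net p)"
    unfolding smoothing_weight_def
    using assms
    by (intro member_le_sum[where f = "\<lambda>j. subfunction_prob net X k N j *
          k (subfunction net p) (subfunction net j)"]) (auto simp: finite_patterns)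
  then show ?thesis
    using assms by (simp add: field_simps)
qed

theorem theorem2p1:
  fixes net :: "('a::euclidean_space, 'b::euclidean_space) relu_net"
    and X :: "'a set" and Y :: "'b set"
    and D :: "('a \<times> 'b) measure"
    and r :: "'a \<times> 'b \<Rightarrow> ('a \<Rightarrow> 'b) \<Rightarrow> real"
    and k :: "('a, 'b) subfun \<Rightarrow> ('a, 'b) subfun \<Rightarrow> real"
    and N :: "bool list \<Rightarrow> nat"
    and i :: "bool list"
    and \<delta> :: real
  assumes "network net \<in> X \<rightarrow> Y"
    and "\<And>p. p \<in> patterns net X \<Longrightarrow> snd (subfunction net p) \<in> X \<rightarrow> Y"
    and "prob_space D"
    and "sets D = sets (data_algebra X Y)"
    and "(\<lambda>z. r z (network net)) \<in> borel_measurable (data_algebra X Y)"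
    and "\<And>z. z \<in> X \<times> Y \<Longrightarrow> 0 \<le> r z (network net) \<and> r z (network net) \<le> 1"
    and "\<And>p q. p \<in> patterns net X \<Longrightarrow> q \<in> patterns net X \<Longrightarrow>
           0 \<le> k (subfunction net p) (subfunction net q)"
    and "dataset_size net X N \<ge> 1"
    and "\<And>p. p \<in> patterns net X \<Longrightarrow> N p > 0 \<Longrightarrow> measure D (region net X p \<times> Y) > 0"
    and "total_weight net X k N > 0"
    and "\<And>l. l \<in> patterns net X \<Longrightarrow> N l > 0 \<Longrightarrow>
           smoothing_weight net X k N (subfunction net l) > 0"
    and "i \<in> patterns net X"
    and "subfunction_prob net X k N i > 0"
    and "0 < \<delta>" and "\<delta> \<le> 1"
  shows "measure (dataset_distribution net X Y D N)
           {S \<in> space (dataset_distribution net X Y D N).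
              expected_risk net X Y D r k N i
              \<le> empirical_risk net X r k N S i
                + 1 / subfunction_prob net X k N i
                  * sqrt (ln (2 / \<delta>) / (2 * real (dataset_size net X N)))}
         > 1 - \<delta>"
proof -
  let ?I = "sample_index net X N" and ?M = "\<lambda>s. region_distribution net X Y D (fst s)"
  let ?P = "subfunction_prob net X k N i" and ?n = "real (dataset_size net X N)"
  let ?Q = "dataset_distribution net X Y D N"
  let ?t = "1 / ?P * sqrt (ln (2 / \<delta>) / (2 * ?n))"
  \<comment> \<open>The weight depends on a sample only through its pattern. Reading the pattern off
    the sample instead of the index makes one function \<open>f\<close> serve all samples.\<close>
  define w where "w p = k (subfunction net p) (subfunction net i)
    / smoothing_weight net X k N (subfunction net p)" for p
  define f where "f z = w (pattern net (fst z)) * r z (network net) / ?n" for z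
  interpret D: prob_space D by fact
  have n: "?n > 0" using assms(8) by simp
  have Q: "?Q = PiM ?I ?M"
    by (simp add: dataset_distribution_def)
  have fin: "finite ?I"
    by (simp add: sample_index_def finite_patterns)
  have ne: "?I \<noteq> {}"
    using assms(8) card_sample_index[of net X N] by auto
  have I: "fst s \<in> patterns net X" "N (fst s) > 0" if "s \<in> ?I" for s
    using that by (auto simp: sample_index_def)
  have A: "region net X (fst s) \<times> Y \<in> sets D" if "s \<in> ?I" for s
    using region_times_in_sets[OF I(1)[OF that]] assms(4) by simp
  have prob: "prob_space (?M s)" if "s \<in> ?I" for s
    unfolding region_distribution_def
    using assms(9)[OF I[OF that]]
    by (intro prob_space_uniform_measure) (auto simp: D.emeasure_eq_measure)
  \<comment> \<open>Any \<open>w\<close> is measurable on the discrete space of patterns, so only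
    the measurability of the pattern and of the error enters.\<close>
  have f_data: "f \<in> borel_measurable (data_algebra X Y)"
    unfolding f_def
    using measurable_compose[OF measurable_pattern_fst, of w borel net X Y] assms(5) by simp
  have f_meas: "f \<in> borel_measurable (?M s)" for s
    using f_data unfolding region_distribution_def
    by (simp add: assms(4) cong: measurable_cong_sets)
  have f_range: "f z \<in> {0..1 / (?n * ?P)}"
    if s: "s \<in> ?I" and z: "z \<in> region net X (fst s) \<times> Y" for s z
  proof -
    have "fst z \<in> {x \<in> X. pattern net x = fst s}" and "snd z \<in> Y"
      using z unfolding region_eq[OF I(1)[OF s]] by (simp_all add: mem_Times_iff)
    then have p: "pattern net (fst z) = fst s" and "z \<in> X \<times> Y"
      by (simp_all add: mem_Times_iff)
    then have r: "0 \<le> r z (network net)" "r z (network net) \<le> 1"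
      using assms(6) by auto
    have "w (fst s) \<le> 1 / ?P"
      unfolding w_def
      by (rule weight_le_inverse_subfunction_prob[OF assms(7,10) assms(11)[OF I[OF s]]
            assms(12) I(1)[OF s] assms(13)])
    moreover have "0 \<le> w (fst s)"
      unfolding w_def using assms(7)[OF I(1)[OF s] assms(12)] assms(11)[OF I[OF s]] by simp
    ultimately have "w (fst s) * r z (network net) \<le> 1 / ?P * 1"
      by (intro mult_mono r(2)) (simp_all add: r(1) less_imp_le[OF assms(13)])
    then have "w (fst s) * r z (network net) / ?n \<le> 1 / ?P / ?n"
      using n by (intro divide_right_mono) auto
    moreover have "0 \<le> w (fst s) * r z (network net) / ?n"
      using \<open>0 \<le> w (fst s)\<close> r(1) by (intro divide_nonneg_nonneg mult_nonneg_nonneg) simp_all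
    ultimately show ?thesis
      unfolding f_def p by (simp add: mult.commute)
  qed
  \<comment> \<open>The conditional distribution gives the complement of the region measure zero, so
    the pointwise bound on the region holds almost surely.\<close>
  have f_AE: "AE z in ?M s. f z \<in> {0..1 / (?n * ?P)}" if "s \<in> ?I" for s
    unfolding region_distribution_def
    by (rule AE_uniform_measureI[OF A[OF that]]) (intro AE_I2 impI f_range[OF that])
  \<comment> \<open>This identity holds for every family \<open>S\<close>, since both sides take the
    weight from the actual pattern of each sample.\<close>
  have risk: "empirical_risk net X r k N S i = (\<Sum>s\<in>?I. f (S s))" for S
    by (simp add: empirical_risk_def f_def w_def induced_subfunction_def sum_distrib_left mult.commute)
  have expected: "expected_risk net X Y D r k N i = (\<integral>S. (\<Sum>s\<in>?I. f (S s)) \<partial>?Q)"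
    by (simp add: expected_risk_def risk)
  interpret Q: prob_space ?Q
    unfolding Q by (rule prob_space_PiM) (rule prob)
  have ln: "ln (2 / \<delta>) > 0"
    using assms(14,15) by simp
  then have t: "?t \<ge> 0"
    using assms(13) by simp
  let ?good = "{S \<in> space ?Q. expected_risk net X Y D r k N i
    \<le> empirical_risk net X r k N S i + ?t}"
  let ?bad = "{S \<in> space ?Q. (\<Sum>s\<in>?I. f (S s)) \<le> expected_risk net X Y D r k N i - ?t}"
  have [measurable]: "(\<lambda>S. \<Sum>s\<in>?I. f (S s)) \<in> borel_measurable ?Q"
    unfolding Q by (intro borel_measurable_sum measurable_PiM_component_rev f_meas)
  have good: "?good \<in> sets ?Q" and bad: "?bad \<in> sets ?Q"
    unfolding risk by measurable
  \<comment> \<open>The deviation \<open>?t\<close> is chosen for this: \<open>?t\<^sup>2\<close> is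
    \<open>ln (2 / \<delta>) / (2 * ?n * ?P\<^sup>2)\<close> and the squared widths add up to
    \<open>1 / (?n * ?P\<^sup>2)\<close>, so both \<open>?n\<close> and \<open>?P\<close>
    cancel.\<close>
  have exponent: "2 * ?t\<^sup>2 / (?n * (1 / (?n * ?P))\<^sup>2) = ln (2 / \<delta>)"
    using n assms(13) ln by (simp add: power_mult_distrib power_divide field_simps power2_eq_square)
  \<comment> \<open>Outside \<open>?good\<close> the inequality defining \<open>?bad\<close> holds
    strictly, so the complement is contained in the non-strict tail event.\<close>
  have "Q.prob (space ?Q - ?good) \<le> Q.prob ?bad"
    using bad by (intro Q.finite_measure_mono) (auto simp: risk)
  also have "\<dots> \<le> exp (- 2 * ?t\<^sup>2 / (real (card ?I) * (1 / (?n * ?P))\<^sup>2))"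
    unfolding expected unfolding Q
    by (rule Hoeffding_PiM_lower_tail[OF fin ne prob f_meas f_AE _ t]) (use n assms(13) in auto)
  also have "\<dots> = exp (- ln (2 / \<delta>))"
    using exponent by (simp add: card_sample_index)
  also have "\<dots> = \<delta> / 2"
    using assms(14) by (simp add: exp_minus)
  finally have "1 - Q.prob ?good \<le> \<delta> / 2"
    using good by (simp add: Q.prob_compl)
  then show ?thesis
    using assms(14) by linarith
qed

end
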